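(* There is no non-zero compact linear finite difference formula on a Moore stencil on a two-dimensional Cartesian grid that approximates second derivatives of $u$ and $v$ and which is stationarity-consistent with the central divergence $$\frac{u_{i+1,j}-u_{i-1,j}}{2\Delta x}+\frac{v_{i,j+1}-v_{i,j-1}}{2\Delta y}.$$
   Context: The grid is Cartesian with constant spacings $\Delta x,\Delta y$ and cells $(i,j)\in\mathbb Z^2$; $u,v$ are the two velocity components, with values $u_{ij},v_{ij}$. The Moore neighborhood of cell $(i,j)$ is the cell itself and the 8 cells $(i,j\pm1)$, $(i\pm1,j)$, $(i\pm1,j\pm1)$; a Moore stencil at $(i,j)$ is a stencil involving only cells from the Moore neighborhood of $(i,j)$. A finite difference formula $\mathcal B$ that vanishes whenever another given finite difference formula $\mathcal A$ does is called stationarity-consistent with $\mathcal A$. Here this is understood via the Fourier transform: a linear finite difference formula $\sum_S(\alpha_Su_{I+S}+\beta_Sv_{I+S})$, $I=(i,j)$, corresponds to the expression $\sum_S(\alpha_S\hat u+\beta_S\hat v)\,t_x^{S_1}t_y^{S_2}$, linear in $\hat u,\hat v$ with Laurent polynomial coefficients in $t_x=\exp(\mathrm ik_x\Delta x)$, $t_y=\exp(\mathrm ik_y\Delta y)$; $\mathcal B$ is stationarity-consistent with $\mathcal A$ if the expression of $\mathcal B$ equals that of $\mathcal A$ times some factor (depending on $t_x,t_y$ only), which need not itself be a Laurent polynomial. *)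

theory Defs
  imports
    "HOL-Analysis.Analysis"
    "HOL-Library.Poly_Mapping"
    "HOL-Library.Landau_Symbols"
begin

section \<open>Linear finite difference formulas\<close>

text \<open>The formula with values \<open>\<Sum>S. \<alpha>\<^sub>S u\<^bsub>I+S\<^esub> + \<beta>\<^sub>S v\<^bsub>I+S\<^esub>\<close>
  is the pair \<open>(\<alpha>, \<beta>)\<close> of its finitely supported coefficient families, indexed by offsets \<open>S\<close>.\<close>

type_synonym fd_formula = "((int \<times> int) \<Rightarrow>\<^sub>0 real) \<times> ((int \<times> int) \<Rightarrow>\<^sub>0 real)"

definition fd_apply ::
  "fd_formula \<Rightarrow> (int \<times> int \<Rightarrow> real) \<Rightarrow> (int \<times> int \<Rightarrow> real) \<Rightarrow> int \<times> int \<Rightarrow> real" where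
  "fd_apply B u v I =
     (\<Sum>S\<in>Poly_Mapping.keys (fst B). Poly_Mapping.lookup (fst B) S * u (I + S)) +
     (\<Sum>S\<in>Poly_Mapping.keys (snd B). Poly_Mapping.lookup (snd B) S * v (I + S))"

definition moore_stencil :: "fd_formula \<Rightarrow> bool" where
  "moore_stencil B \<longleftrightarrow> Poly_Mapping.keys (fst B) \<union> Poly_Mapping.keys (snd B) \<subseteq> {-1..1} \<times> {-1..1}"

definition central_divergence :: "real \<Rightarrow> real \<Rightarrow> fd_formula" where
  "central_divergence dx dy =
     (Poly_Mapping.single (1, 0) (1 / (2 * dx)) - Poly_Mapping.single (-1, 0) (1 / (2 * dx)),
      Poly_Mapping.single (0, 1) (1 / (2 * dy)) - Poly_Mapping.single (0, -1) (1 / (2 * dy)))"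


section \<open>Stationarity consistency\<close>

definition fd_symbol ::
  "fd_formula \<Rightarrow> complex \<Rightarrow> complex \<Rightarrow> complex \<Rightarrow> complex \<Rightarrow> complex" where
  "fd_symbol B tx ty uhat vhat =
     (\<Sum>S\<in>Poly_Mapping.keys (fst B). of_real (Poly_Mapping.lookup (fst B) S) * uhat * tx powi (fst S) * ty powi (snd S)) +
     (\<Sum>S\<in>Poly_Mapping.keys (snd B). of_real (Poly_Mapping.lookup (snd B) S) * vhat * tx powi (fst S) * ty powi (snd S))"

text \<open>The factor \<open>f\<close> need not be a Laurent polynomial: it may be a quotient of Laurent
  polynomials, whose poles form a null set of wave numbers. Hence the two expressions are only
  compared at almost every wave number \<open>k\<close>.\<close>

definition stationarity_consistent :: "real \<Rightarrow> real \<Rightarrow> fd_formula \<Rightarrow> fd_formula \<Rightarrow> bool" where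
  "stationarity_consistent dx dy B A \<longleftrightarrow>
     (\<exists>f :: complex \<Rightarrow> complex \<Rightarrow> complex.
        AE k in (lborel :: (real \<times> real) measure).
          let tx = exp (\<i> * of_real (fst k * dx)); ty = exp (\<i> * of_real (snd k * dy))
          in \<forall>uhat vhat. fd_symbol B tx ty uhat vhat = f tx ty * fd_symbol A tx ty uhat vhat)"


section \<open>Approximation of second derivatives\<close>

definition partial_x :: "(real \<Rightarrow> real \<Rightarrow> real) \<Rightarrow> real \<Rightarrow> real \<Rightarrow> real" where
  "partial_x f x y = deriv (\<lambda>s. f s y) x"

definition partial_y :: "(real \<Rightarrow> real \<Rightarrow> real) \<Rightarrow> real \<Rightarrow> real \<Rightarrow> real" where
  "partial_y f x y = deriv (\<lambda>s. f x s) y"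

primrec cont_diff :: "nat \<Rightarrow> (real \<Rightarrow> real \<Rightarrow> real) \<Rightarrow> bool" where
  "cont_diff 0 f \<longleftrightarrow> continuous_on UNIV (\<lambda>(x, y). f x y)"
| "cont_diff (Suc n) f \<longleftrightarrow>
     continuous_on UNIV (\<lambda>(x, y). f x y) \<and>
     (\<forall>x y. (\<lambda>s. f s y) field_differentiable at x) \<and>
     (\<forall>x y. (\<lambda>s. f x s) field_differentiable at y) \<and>
     cont_diff n (partial_x f) \<and> cont_diff n (partial_y f)"

definition smooth_fun :: "(real \<Rightarrow> real \<Rightarrow> real) \<Rightarrow> bool" where
  "smooth_fun f \<longleftrightarrow> (\<forall>n. cont_diff n f)"

fun second_order_op :: "real \<times> real \<times> real \<Rightarrow> (real \<Rightarrow> real \<Rightarrow> real) \<Rightarrow> real \<Rightarrow> real \<Rightarrow> real" where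
  "second_order_op (a, b, c) f x y =
     a * partial_x (partial_x f) x y + b * partial_x (partial_y f) x y + c * partial_y (partial_y f) x y"

definition grid_values ::
  "real \<Rightarrow> real \<Rightarrow> real \<Rightarrow> real \<Rightarrow> (real \<Rightarrow> real \<Rightarrow> real) \<Rightarrow> int \<times> int \<Rightarrow> real" where
  "grid_values dx dy x y q I = q (x + of_int (fst I) * dx) (y + of_int (snd I) * dy)"

text \<open>Approximation is a statement about grid refinement, so \<open>B n\<close> is the formula used on the grid
  with spacings \<open>dx n\<close>, \<open>dy n\<close>. The coefficients \<open>p n\<close>, \<open>q n\<close> of the second derivatives
  of \<open>u\<close>, \<open>v\<close> may depend on the spacings (as in \<open>u\<^bsub>i+1\<^esub> - 2 u\<^sub>i + u\<^bsub>i-1\<^esub>\<close>, which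
  approximates \<open>dx\<^sup>2\<close> times the second derivative), and the error has to be small relative
  to their size.\<close>

definition approximates_second_derivatives ::
  "(nat \<Rightarrow> real) \<Rightarrow> (nat \<Rightarrow> real) \<Rightarrow> (nat \<Rightarrow> fd_formula) \<Rightarrow> bool" where
  "approximates_second_derivatives dx dy B \<longleftrightarrow>
     (\<exists>p q :: nat \<Rightarrow> real \<times> real \<times> real.
        \<forall>u v x y. smooth_fun u \<longrightarrow> smooth_fun v \<longrightarrow>
          (\<lambda>n. fd_apply (B n) (grid_values (dx n) (dy n) x y u) (grid_values (dx n) (dy n) x y v) (0, 0)
               - (second_order_op (p n) u x y + second_order_op (q n) v x y))
          \<in> o(\<lambda>n. norm (p n, q n)))"

end

theory Submission
  imports Defs
begin

text \<open>
  The proof rests on the fact that consistency with the central divergence leaves a Moore stencil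
  no freedom beyond scaling, and the central divergence is a first-order operator.

  Let \<open>\<alpha>\<close> and \<open>\<beta>\<close> be the Laurent polynomials that multiply \<open>u\<close> and \<open>v\<close> in the Fourier expression
  of the formula. Eliminating the unknown factor \<open>f\<close> from \<open>\<alpha> = f (t - 1/t) / 2dx\<close> and
  \<open>\<beta> = f (s - 1/s) / 2dy\<close> gives \<open>\<alpha> (s - 1/s) / dy = \<beta> (t - 1/t) / dx\<close> for almost every wave
  number. Both sides are continuous, so this holds on the whole torus, and a Laurent polynomial
  that vanishes on the torus is zero; the equation therefore amounts to linear relations
  between the coefficients of the stencil (\<open>stationarity_consistent_coefficients\<close>). When all of
  them sit in the Moore neighborhood, these relations leave only the \<open>u\<close>-coefficients at the
  horizontal neighbors and the \<open>v\<close>-coefficients at the vertical ones, and force them to be those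
  of the divergence up to one constant \<open>c\<close>
  (\<open>moore_stationarity_consistent_multiple\<close>).

  Such a multiple is then tested on quadratic polynomials at the origin. For \<open>u = x\<close> the
  difference formula returns \<open>c\<close> while all second derivatives vanish, so \<open>c\<close> is small compared to
  the coefficients \<open>(p, q)\<close> of the approximated operator. For \<open>u\<close> or \<open>v\<close> one of \<open>x\<^sup>2\<close>, \<open>x y\<close>, \<open>y\<^sup>2\<close> the
  central differences vanish by symmetry while a second derivative does not, so each entry of
  \<open>(p, q)\<close> is small compared to \<open>(p, q)\<close> itself. Hence \<open>(p, q) = 0\<close> on all fine grids, and then
  \<open>c = 0\<close> (\<open>multiple_of_central_divergence_not_second_order\<close>), so the formula is zero.
\<close>

section \<open>Laurent polynomials on the unit torus\<close>

text \<open>Multiplication by a power of \<open>t\<close>, which has no zero on the circle, turns the Laurent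
  polynomial into a polynomial with infinitely many roots.\<close>

lemma laurent_polynomial_circle_zero:
  fixes c :: "int \<Rightarrow> complex"
  assumes "finite F"
    and zero: "\<And>t. norm t = 1 \<Longrightarrow> (\<Sum>m\<in>F. c m * t powi m) = 0"
    and "m \<in> F"
  shows "c m = 0"
proof -
  \<comment> \<open>\<open>N\<close> only has to make every exponent \<open>m + N\<close> nonnegative.\<close>
  obtain N where N: "\<And>m. m \<in> F \<Longrightarrow> -N \<le> m"
  proof -
    have "\<forall>m\<in>F. - (\<Sum>m\<in>F. \<bar>m\<bar>) \<le> m"
      using member_le_sum[OF _ _ \<open>finite F\<close>, of _ abs] by force
    then show ?thesis using that by blast
  qed
  define P where "P = (\<Sum>m\<in>F. monom (c m) (nat (m + N)))"
  have "poly P t = 0" if t: "norm t = 1" for t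
  proof -
    have "t \<noteq> 0" using t by auto
    have "poly P t = (\<Sum>m\<in>F. c m * t ^ nat (m + N))"
      by (simp add: P_def poly_sum poly_monom)
    also have "\<dots> = (\<Sum>m\<in>F. t powi N * (c m * t powi m))"
    proof (rule sum.cong)
      fix m assume "m \<in> F"
      then have "0 \<le> m + N" using N[of m] by simp
      then have "t ^ nat (m + N) = t powi (m + N)"
        by (simp add: power_int_def)
      then show "c m * t ^ nat (m + N) = t powi N * (c m * t powi m)"
        using \<open>t \<noteq> 0\<close> by (simp add: power_int_add)
    qed simp
    also have "\<dots> = 0"
      using zero[OF t] by (simp flip: sum_distrib_left)
    finally show ?thesis .
  qed
  then have "sphere 0 1 \<subseteq> {t. poly P t = 0}"
    by (auto simp: dist_norm)
  moreover have "infinite (sphere (0 :: complex) 1)"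
    by (intro uncountable_infinite connected_uncountable[of _ 1 "-1"] connected_sphere) auto
  ultimately have "P = 0"
    using poly_roots_finite finite_subset by blast
  have "0 = coeff P (nat (m + N))"
    using \<open>P = 0\<close> by simp
  also have "\<dots> = (\<Sum>k\<in>F. if k = m then c k else 0)"
    unfolding P_def coeff_sum coeff_monom
    using N \<open>m \<in> F\<close> by (intro sum.cong if_cong) (auto simp: nat_eq_iff2, force+)
  also have "\<dots> = c m"
    using \<open>finite F\<close> \<open>m \<in> F\<close> by simp
  finally show ?thesis by simp
qed

text \<open>For fixed \<open>s\<close> the coefficients in \<open>t\<close> vanish; each of them is a Laurent polynomial in \<open>s\<close> that
  vanishes on the circle in turn.\<close>

lemma laurent_polynomial_torus_zero:
  fixes c :: "int \<times> int \<Rightarrow> complex"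
  assumes "finite F" "finite G"
    and zero: "\<And>t s. norm t = 1 \<Longrightarrow> norm s = 1 \<Longrightarrow>
                 (\<Sum>S\<in>F \<times> G. c S * t powi fst S * s powi snd S) = 0"
    and "S \<in> F \<times> G"
  shows "c S = 0"
proof -
  obtain m n where S: "S = (m, n)" "m \<in> F" "n \<in> G"
    using \<open>S \<in> F \<times> G\<close> by auto
  have "(\<Sum>n\<in>G. c (m, n) * s powi n) = 0" if "norm s = 1" for s
    using \<open>finite F\<close> _ \<open>m \<in> F\<close>
  proof (rule laurent_polynomial_circle_zero)
    fix t :: complex assume "norm t = 1"
    have "(\<Sum>m\<in>F. (\<Sum>n\<in>G. c (m, n) * s powi n) * t powi m)
        = (\<Sum>m\<in>F. \<Sum>n\<in>G. c (m, n) * t powi m * s powi n)"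
      by (simp add: sum_distrib_left sum_distrib_right mult_ac)
    also have "\<dots> = (\<Sum>S\<in>F \<times> G. c S * t powi fst S * s powi snd S)"
      by (simp add: sum.cartesian_product case_prod_unfold)
    also have "\<dots> = 0"
      using zero \<open>norm t = 1\<close> \<open>norm s = 1\<close> by blast
    finally show "(\<Sum>m\<in>F. (\<Sum>n\<in>G. c (m, n) * s powi n) * t powi m) = 0" .
  qed
  then show ?thesis
    using laurent_polynomial_circle_zero[OF \<open>finite G\<close>, of "\<lambda>n. c (m, n)" n] S by simp
qed

text \<open>The set where a continuous function is nonzero is open, and a nonempty open set is not a null
  set. This removes the exceptional wave numbers at which the factor of stationarity consistency
  may have a pole.\<close>

lemma AE_lborel_continuous_zero:
  fixes g :: "'a::euclidean_space \<Rightarrow> 'b::real_normed_vector"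
  assumes "continuous_on UNIV g" and "AE x in lborel. g x = 0"
  shows "g x = 0"
proof -
  have "open {x. g x \<noteq> 0}"
    using assms(1) by (intro open_Collect_neq continuous_on_const)
  moreover have "negligible {x. g x \<noteq> 0}"
  proof -
    have "{x. g x \<noteq> 0} \<in> sets lborel"
      using \<open>open {x. g x \<noteq> 0}\<close> by simp
    then have "{x. g x \<noteq> 0} \<in> null_sets lborel"
      using assms(2) by (simp add: AE_iff_null_sets)
    then show ?thesis
      by (simp add: negligible_iff_null_sets null_sets_completionI)
  qed
  ultimately show ?thesis
    using open_not_negligible by blast
qed

text \<open>Nonzero spacings ensure that every point of the torus comes from some wave number.\<close>

lemma laurent_polynomial_wave_numbers_zero:
  fixes c :: "int \<times> int \<Rightarrow> complex"
  assumes "finite F" "finite G" and "dx \<noteq> 0" "dy \<noteq> 0"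
    and zero: "AE k in (lborel :: (real \<times> real) measure).
       (\<Sum>S\<in>F \<times> G. c S * exp (\<i> * of_real (fst k * dx)) powi fst S
                          * exp (\<i> * of_real (snd k * dy)) powi snd S) = 0"
    and "S \<in> F \<times> G"
  shows "c S = 0"
  using assms(1,2) _ \<open>S \<in> F \<times> G\<close>
proof (rule laurent_polynomial_torus_zero)
  fix t s :: complex assume "norm t = 1" "norm s = 1"
  then have t: "t = exp (\<i> * of_real (Arg t / dx * dx))"
    and s: "s = exp (\<i> * of_real (Arg s / dy * dy))"
    using Arg_eq[of t] Arg_eq[of s] assms(3,4) by force+
  have "(\<Sum>S\<in>F \<times> G. c S * exp (\<i> * of_real (fst k * dx)) powi fst S
                          * exp (\<i> * of_real (snd k * dy)) powi snd S) = 0" for k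
    by (rule AE_lborel_continuous_zero[OF _ zero]) (intro continuous_intros, auto)
  from this[of "(Arg t / dx, Arg s / dy)"]
  show "(\<Sum>S\<in>F \<times> G. c S * t powi fst S * s powi snd S) = 0"
    unfolding fst_conv snd_conv t[symmetric] s[symmetric] .
qed

text \<open>Translating a stencil by \<open>K\<close> multiplies its symbol by the monomial with exponent \<open>K\<close>. The
  larger index set \<open>F\<close> allows several translates of one stencil to be summed over a common set.\<close>

lemma laurent_polynomial_shift:
  fixes a :: "int \<times> int \<Rightarrow> complex"
  assumes "finite F" and "t \<noteq> 0" "s \<noteq> 0"
    and "\<And>S. S \<in> G \<Longrightarrow> S + K \<in> F" and "\<And>S. S \<notin> G \<Longrightarrow> a S = 0"
  shows "(\<Sum>S\<in>F. a (S - K) * t powi fst S * s powi snd S)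
       = t powi fst K * s powi snd K * (\<Sum>S\<in>G. a S * t powi fst S * s powi snd S)"
proof -
  have "(\<Sum>S\<in>F. a (S - K) * t powi fst S * s powi snd S)
      = (\<Sum>S\<in>(\<lambda>S. S + K) ` G. a (S - K) * t powi fst S * s powi snd S)"
  proof (rule sum.mono_neutral_right)
    show "\<forall>S\<in>F - (\<lambda>S. S + K) ` G. a (S - K) * t powi fst S * s powi snd S = 0"
    proof
      fix S assume "S \<in> F - (\<lambda>S. S + K) ` G"
      then have "S - K \<notin> G" by (metis DiffE diff_add_cancel image_eqI)
      then show "a (S - K) * t powi fst S * s powi snd S = 0" using assms(5) by simp
    qed
  qed (use assms in auto)
  also have "\<dots> = (\<Sum>S\<in>G. a S * t powi fst (S + K) * s powi snd (S + K))"
    by (subst sum.reindex) (auto simp: inj_on_def)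
  also have "\<dots> = t powi fst K * s powi snd K * (\<Sum>S\<in>G. a S * t powi fst S * s powi snd S)"
    using assms(2,3) by (simp add: power_int_add sum_distrib_left mult_ac)
  finally show ?thesis .
qed

section \<open>Formulas consistent with the central divergence\<close>

text \<open>The sums in a symbol and in an application run over the exact supports of the coefficient
  families; a common larger index set makes different formulas comparable.\<close>

lemma fd_symbol_superset:
  assumes "finite F" and "Poly_Mapping.keys (fst B) \<union> Poly_Mapping.keys (snd B) \<subseteq> F"
  shows "fd_symbol B t s w z =
     w * (\<Sum>S\<in>F. of_real (Poly_Mapping.lookup (fst B) S) * t powi fst S * s powi snd S)
   + z * (\<Sum>S\<in>F. of_real (Poly_Mapping.lookup (snd B) S) * t powi fst S * s powi snd S)"
proof -
  have "(\<Sum>S\<in>Poly_Mapping.keys p. of_real (Poly_Mapping.lookup p S) * w * t powi fst S * s powi snd S)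
      = w * (\<Sum>S\<in>F. of_real (Poly_Mapping.lookup p S) * t powi fst S * s powi snd S)"
    if "Poly_Mapping.keys p \<subseteq> F" for p w
    unfolding sum_distrib_left using that \<open>finite F\<close>
    by (intro sum.mono_neutral_cong_left) (auto simp: in_keys_iff)
  then show ?thesis
    using assms(2) by (simp add: fd_symbol_def)
qed

lemma fd_apply_superset:
  assumes "finite F" and "Poly_Mapping.keys (fst B) \<union> Poly_Mapping.keys (snd B) \<subseteq> F"
  shows "fd_apply B u v I =
     (\<Sum>S\<in>F. Poly_Mapping.lookup (fst B) S * u (I + S))
   + (\<Sum>S\<in>F. Poly_Mapping.lookup (snd B) S * v (I + S))"
  unfolding fd_apply_def using assms
  by (intro arg_cong2[of _ _ _ _ "(+)"] sum.mono_neutral_left) (auto simp: in_keys_iff)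

lemma keys_central_divergence:
  "Poly_Mapping.keys (fst (central_divergence dx dy)) \<union> Poly_Mapping.keys (snd (central_divergence dx dy))
     \<subseteq> {(1, 0), (-1, 0), (0, 1), (0, -1)}"
  by (auto simp: central_divergence_def in_keys_iff lookup_minus lookup_single when_def split: if_splits)

lemma fd_symbol_central_divergence:
  "fd_symbol (central_divergence dx dy) t s w z =
     w * ((t - inverse t) / of_real (2 * dx)) + z * ((s - inverse s) / of_real (2 * dy))"
  unfolding fd_symbol_superset[OF _ keys_central_divergence, simplified]
  by (simp add: central_divergence_def lookup_minus lookup_single power_int_minus diff_divide_distrib
      inverse_eq_divide mult.commute)

lemma fd_apply_central_divergence:
  "fd_apply (central_divergence dx dy) u v I =
     (u (I + (1, 0)) - u (I + (-1, 0))) / (2 * dx) + (v (I + (0, 1)) - v (I + (0, -1))) / (2 * dy)"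
  unfolding fd_apply_superset[OF _ keys_central_divergence, simplified]
  by (simp add: central_divergence_def lookup_minus lookup_single diff_divide_distrib)

text \<open>Cross-multiplying the two components eliminates the factor: the symbol of the \<open>u\<close>-part times
  \<open>(s - 1/s) / dy\<close> equals the symbol of the \<open>v\<close>-part times \<open>(t - 1/t) / dx\<close>. The equation below
  compares the coefficients of the monomial with exponent \<open>S\<close>; it holds for stencils of any size.\<close>

lemma stationarity_consistent_coefficients:
  fixes B :: fd_formula
  assumes "dx \<noteq> 0" "dy \<noteq> 0"
    and "stationarity_consistent dx dy B (central_divergence dx dy)"
  defines "a \<equiv> Poly_Mapping.lookup (fst B)" and "b \<equiv> Poly_Mapping.lookup (snd B)"
  shows "(a (S - (0, 1)) - a (S + (0, 1))) / dy = (b (S - (1, 0)) - b (S + (1, 0))) / dx"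
proof -
  obtain f where "AE k in (lborel :: (real \<times> real) measure).
      let t = exp (\<i> * of_real (fst k * dx)); s = exp (\<i> * of_real (snd k * dy))
      in \<forall>w z. fd_symbol B t s w z = f t s * fd_symbol (central_divergence dx dy) t s w z"
    using assms(3) unfolding stationarity_consistent_def by blast
  note consistent = this
  \<comment> \<open>The stencil lies in \<open>X \<times> Y\<close>, and its four unit translates in the enlarged box \<open>X' \<times> Y'\<close>.\<close>
  define K where "K = Poly_Mapping.keys (fst B) \<union> Poly_Mapping.keys (snd B)"
  define X where "X = fst ` K"
  define Y where "Y = snd ` K"
  have "finite K" by (simp add: K_def)
  then have fin: "finite X" "finite Y" by (simp_all add: X_def Y_def)
  have KXY: "K \<subseteq> X \<times> Y" by (force simp: X_def Y_def)
  then have zero: "a S = 0" "b S = 0" if "S \<notin> X \<times> Y" for S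
    using that by (auto simp: a_def b_def K_def in_keys_iff)
  define X' where "X' = X \<union> (\<lambda>x. x + 1) ` X \<union> (\<lambda>x. x - 1) ` X"
  define Y' where "Y' = Y \<union> (\<lambda>y. y + 1) ` Y \<union> (\<lambda>y. y - 1) ` Y"
  have fin': "finite X'" "finite Y'" using fin by (simp_all add: X'_def Y'_def)
  have shifted: "S + (1, 0) \<in> X' \<times> Y'" "S + (-1, 0) \<in> X' \<times> Y'"
    "S + (0, 1) \<in> X' \<times> Y'" "S + (0, -1) \<in> X' \<times> Y'" if "S \<in> X \<times> Y" for S
    using that by (cases S; force simp: X'_def Y'_def)+
  define c where
    "c S = (a (S - (0, 1)) - a (S + (0, 1))) / dy - (b (S - (1, 0)) - b (S + (1, 0))) / dx" for S
  have "c S = 0"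
  proof (cases "S \<in> X' \<times> Y'")
    case False
    then have "S - (0, 1) \<notin> X \<times> Y" "S + (0, 1) \<notin> X \<times> Y" "S - (1, 0) \<notin> X \<times> Y" "S + (1, 0) \<notin> X \<times> Y"
      using shifted(3)[of "S - (0, 1)"] shifted(4)[of "S + (0, 1)"]
        shifted(1)[of "S - (1, 0)"] shifted(2)[of "S + (1, 0)"]
      by (cases S; auto)+
    then show ?thesis by (simp add: c_def zero)
  next
    case True
    have "AE k in (lborel :: (real \<times> real) measure).
       (\<Sum>S\<in>X' \<times> Y'. of_real (c S) * exp (\<i> * of_real (fst k * dx)) powi fst S
                          * exp (\<i> * of_real (snd k * dy)) powi snd S) = 0"
      using consistent
    proof (rule eventually_mono)
      fix k :: "real \<times> real"
      define t where "t = exp (\<i> * of_real (fst k * dx))"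
      define s where "s = exp (\<i> * of_real (snd k * dy))"
      have nz: "t \<noteq> 0" "s \<noteq> 0" by (simp_all add: t_def s_def)
      define \<alpha> where "\<alpha> = (\<Sum>S\<in>X \<times> Y. of_real (a S) * t powi fst S * s powi snd S)"
      define \<beta> where "\<beta> = (\<Sum>S\<in>X \<times> Y. of_real (b S) * t powi fst S * s powi snd S)"
      assume "let t = exp (\<i> * of_real (fst k * dx)); s = exp (\<i> * of_real (snd k * dy))
        in \<forall>w z. fd_symbol B t s w z = f t s * fd_symbol (central_divergence dx dy) t s w z"
      then have eq: "fd_symbol B t s w z = f t s * fd_symbol (central_divergence dx dy) t s w z" for w z
        by (simp add: t_def s_def Let_def)
      have "fd_symbol B t s w z = w * \<alpha> + z * \<beta>" for w z
        unfolding \<alpha>_def \<beta>_def a_def b_def using fin KXY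
        by (intro fd_symbol_superset) (simp_all add: K_def)
      \<comment> \<open>The expressions agree as linear forms in the two Fourier amplitudes, so each amplitude
        can be isolated.\<close>
      then have "\<alpha> = f t s * ((t - inverse t) / of_real (2 * dx))"
        and "\<beta> = f t s * ((s - inverse s) / of_real (2 * dy))"
        using eq[of 1 0] eq[of 0 1] by (simp_all add: fd_symbol_central_divergence)
      then have cross: "(s - inverse s) * \<alpha> / of_real dy = (t - inverse t) * \<beta> / of_real dx"
        using assms(1,2) by (simp add: mult_ac)
      have "(\<Sum>S\<in>X' \<times> Y'. of_real (a (S - K)) * t powi fst S * s powi snd S)
          = t powi fst K * s powi snd K * \<alpha>"
        if "\<And>S. S \<in> X \<times> Y \<Longrightarrow> S + K \<in> X' \<times> Y'" for K
        unfolding \<alpha>_def using laurent_polynomial_shift[of "X' \<times> Y'" t s "X \<times> Y" K "\<lambda>S. of_real (a S)"]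
          that nz fin' zero by auto
      from this[of "(0, 1)"] this[of "(0, -1)"]
      have A: "(\<Sum>S\<in>X' \<times> Y'. of_real (a (S - (0, 1))) * t powi fst S * s powi snd S) = s * \<alpha>"
        "(\<Sum>S\<in>X' \<times> Y'. of_real (a (S + (0, 1))) * t powi fst S * s powi snd S) = inverse s * \<alpha>"
        using shifted by (simp_all add: power_int_minus minus_prod_def plus_prod_def)
      have "(\<Sum>S\<in>X' \<times> Y'. of_real (b (S - K)) * t powi fst S * s powi snd S)
          = t powi fst K * s powi snd K * \<beta>"
        if "\<And>S. S \<in> X \<times> Y \<Longrightarrow> S + K \<in> X' \<times> Y'" for K
        unfolding \<beta>_def using laurent_polynomial_shift[of "X' \<times> Y'" t s "X \<times> Y" K "\<lambda>S. of_real (b S)"]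
          that nz fin' zero by auto
      from this[of "(1, 0)"] this[of "(-1, 0)"]
      have B: "(\<Sum>S\<in>X' \<times> Y'. of_real (b (S - (1, 0))) * t powi fst S * s powi snd S) = t * \<beta>"
        "(\<Sum>S\<in>X' \<times> Y'. of_real (b (S + (1, 0))) * t powi fst S * s powi snd S) = inverse t * \<beta>"
        using shifted by (simp_all add: power_int_minus minus_prod_def plus_prod_def)
      have "(\<Sum>S\<in>X' \<times> Y'. of_real (c S) * t powi fst S * s powi snd S)
          = (s * \<alpha> - inverse s * \<alpha>) / of_real dy - (t * \<beta> - inverse t * \<beta>) / of_real dx"
        unfolding A[symmetric] B[symmetric] c_def
        by (simp add: sum_divide_distrib sum_subtractf diff_divide_distrib left_diff_distrib)
      also have "\<dots> = 0"
        using cross by (simp add: left_diff_distrib)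
      finally show "(\<Sum>S\<in>X' \<times> Y'. of_real (c S) * exp (\<i> * of_real (fst k * dx)) powi fst S
                          * exp (\<i> * of_real (snd k * dy)) powi snd S) = 0"
        by (simp add: t_def s_def)
    qed
    from laurent_polynomial_wave_numbers_zero[OF fin' assms(1,2) this True]
    show ?thesis by simp
  qed
  then show ?thesis
    by (simp add: c_def)
qed

text \<open>The coefficient equations at exponents two steps from the centre involve a single coefficient
  inside the Moore neighborhood, which must vanish: this removes the \<open>u\<close>-coefficients in the rows
  \<open>j = \<plusminus>1\<close> and the \<open>v\<close>-coefficients in the columns \<open>i = \<plusminus>1\<close>. The equations at the axis neighbors
  then remove the central coefficients, and those at the corners tie the four remaining
  coefficients to one constant.\<close>

lemma moore_stationarity_consistent_multiple:
  fixes B :: fd_formula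
  assumes "dx \<noteq> 0" "dy \<noteq> 0" and moore: "moore_stencil B"
    and "stationarity_consistent dx dy B (central_divergence dx dy)"
  obtains c where
    "\<And>S. Poly_Mapping.lookup (fst B) S = c * Poly_Mapping.lookup (fst (central_divergence dx dy)) S"
    "\<And>S. Poly_Mapping.lookup (snd B) S = c * Poly_Mapping.lookup (snd (central_divergence dx dy)) S"
proof -
  define a where "a = Poly_Mapping.lookup (fst B)"
  define b where "b = Poly_Mapping.lookup (snd B)"
  have outside: "a (i, j) = 0" "b (i, j) = 0" if "\<bar>i\<bar> > 1 \<or> \<bar>j\<bar> > 1" for i j
  proof -
    have "(i, j) \<notin> {-1..1} \<times> {-1..1}"
      using that by auto
    then have "(i, j) \<notin> Poly_Mapping.keys (fst B)" "(i, j) \<notin> Poly_Mapping.keys (snd B)"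
      using moore unfolding moore_stencil_def by blast+
    then show "a (i, j) = 0" "b (i, j) = 0"
      by (simp_all add: a_def b_def in_keys_iff)
  qed
  have E: "(a (i, j - 1) - a (i, j + 1)) / dy = (b (i - 1, j) - b (i + 1, j)) / dx" for i j
    using stationarity_consistent_coefficients[OF assms(1,2,4), of "(i, j)"]
    by (simp add: a_def b_def)
  have rows_a: "a (i, 1) = 0" "a (i, -1) = 0" for i
    using E[of i 2] E[of i "-2"] assms(1,2) by (simp_all add: outside)
  have columns_b: "b (1, j) = 0" "b (-1, j) = 0" for j
    using E[of 2 j] E[of "-2" j] assms(1,2) by (simp_all add: outside)
  have centre: "a (0, 0) = 0" "b (0, 0) = 0"
    using E[of 0 1] E[of 1 0] assms(1,2) by (simp_all add: outside rows_a columns_b)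
  \<comment> \<open>The divergence has coefficient \<open>1 / (2 * dx)\<close> at offset \<open>(1, 0)\<close>, which forces this constant.\<close>
  define c where "c = 2 * dx * a (1, 0)"
  have b1: "b (0, 1) = c / (2 * dy)"
    using E[of 1 1] assms(1,2) by (simp add: outside c_def field_simps)
  have b2: "b (0, -1) = - c / (2 * dy)"
    using E[of 1 "-1"] assms(1,2) by (simp add: outside c_def field_simps)
  have a1: "a (1, 0) = c / (2 * dx)"
    using assms(1) by (simp add: c_def)
  have a2: "a (-1, 0) = - c / (2 * dx)"
    using E[of "-1" 1] assms(1,2) by (simp add: outside b1 field_simps)
  have S_cases: "(\<bar>i\<bar> > 1 \<or> \<bar>j\<bar> > 1) \<or> ((i = 0 \<or> i = 1 \<or> i = -1) \<and> (j = 0 \<or> j = 1 \<or> j = -1))" for i j :: int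
    by linarith
  have "a (i, j) = c * Poly_Mapping.lookup (fst (central_divergence dx dy)) (i, j)"
    "b (i, j) = c * Poly_Mapping.lookup (snd (central_divergence dx dy)) (i, j)" for i j
    using S_cases[of i j]
    by (elim disjE conjE;
        force simp: central_divergence_def lookup_minus lookup_single when_def outside
          rows_a columns_b centre a1 a2 b1 b2)+
  then show ?thesis
    using that unfolding a_def b_def by (metis surj_pair)
qed

section \<open>Second-order consistency tested on quadratic polynomials\<close>

definition quadratic ::
  "real \<Rightarrow> real \<Rightarrow> real \<Rightarrow> real \<Rightarrow> real \<Rightarrow> real \<Rightarrow> real \<Rightarrow> real \<Rightarrow> real" where
  "quadratic a b c d e f x y = a + b * x + c * y + d * x\<^sup>2 + e * x * y + f * y\<^sup>2"

text \<open>Quadratic polynomials are closed under partial derivatives, which makes smoothness a direct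
  induction and reduces second derivatives to reading off coefficients.\<close>

lemma partial_x_quadratic: "partial_x (quadratic a b c d e f) = quadratic b (2 * d) e 0 0 0"
  unfolding partial_x_def quadratic_def
  by (intro ext DERIV_imp_deriv) (auto intro!: derivative_eq_intros simp: algebra_simps)

lemma partial_y_quadratic: "partial_y (quadratic a b c d e f) = quadratic c e (2 * f) 0 0 0"
  unfolding partial_y_def quadratic_def
  by (intro ext DERIV_imp_deriv) (auto intro!: derivative_eq_intros simp: algebra_simps)

lemma smooth_fun_quadratic: "smooth_fun (quadratic a b c d e f)"
proof -
  have cont: "continuous_on UNIV (\<lambda>(x, y). quadratic a b c d e f x y)" for a b c d e f
    unfolding quadratic_def case_prod_unfold by (intro continuous_intros)
  have diff: "(\<lambda>s. quadratic a b c d e f s y) field_differentiable at x"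
    "(\<lambda>s. quadratic a b c d e f x s) field_differentiable at y" for a b c d e f x y
    unfolding quadratic_def by (intro derivative_intros)+
  have "cont_diff n (quadratic a b c d e f)" for n
    by (induction n arbitrary: a b c d e f)
       (simp_all add: cont diff partial_x_quadratic partial_y_quadratic)
  then show ?thesis
    by (simp add: smooth_fun_def)
qed

lemma second_order_op_quadratic:
  "second_order_op p (quadratic a b c d e f) x y
     = 2 * d * fst p + e * fst (snd p) + 2 * f * snd (snd p)"
  by (cases p) (simp add: partial_x_quadratic partial_y_quadratic quadratic_def)

text \<open>At the origin the even terms \<open>x\<^sup>2\<close>, \<open>y\<^sup>2\<close> cancel in the symmetric differences, and \<open>x y\<close> vanishes on
  the axes; only the slope of \<open>u\<close> in \<open>x\<close> and that of \<open>v\<close> in \<open>y\<close> survive, with no discretization error.\<close>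

lemma central_divergence_quadratic:
  assumes "dx \<noteq> 0" "dy \<noteq> 0"
  shows "fd_apply (central_divergence dx dy)
           (grid_values dx dy 0 0 (quadratic a b c d e f))
           (grid_values dx dy 0 0 (quadratic a' b' c' d' e' f')) (0, 0) = b + c'"
  using assms by (simp add: fd_apply_central_divergence grid_values_def quadratic_def field_simps)

lemma norm_coefficient_pair_le:
  fixes p q :: "real \<times> real \<times> real"
  shows "norm (p, q) \<le> \<bar>fst p\<bar> + \<bar>fst (snd p)\<bar> + \<bar>snd (snd p)\<bar> +
           (\<bar>fst q\<bar> + \<bar>fst (snd q)\<bar> + \<bar>snd (snd q)\<bar>)"
proof -
  have "norm r \<le> \<bar>fst r\<bar> + \<bar>fst (snd r)\<bar> + \<bar>snd (snd r)\<bar>" for r :: "real \<times> real \<times> real"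
    using norm_Pair_le[of "fst r" "snd r"] norm_Pair_le[of "fst (snd r)" "snd (snd r)"] by simp
  from this[of p] this[of q] show ?thesis
    using norm_Pair_le[of p q] by linarith
qed

text \<open>Each test polynomial isolates one quantity: a linear one isolates \<open>c\<close>, a purely quadratic one
  isolates an entry of \<open>p\<close> or \<open>q\<close>. All of them turn out to be of smaller order than
  \<open>norm (p, q)\<close>. A sequence of smaller order than itself is eventually zero, and the error bound
  for \<open>c\<close> then reads \<open>\<bar>c\<bar> \<le> 0\<close>.\<close>

lemma multiple_of_central_divergence_not_second_order:
  assumes "\<And>n. dx n \<noteq> 0" "\<And>n. dy n \<noteq> 0"
    and apply_B: "\<And>n u v I. fd_apply (B n) u v I = c n * fd_apply (central_divergence (dx n) (dy n)) u v I"
    and "approximates_second_derivatives dx dy B"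
  shows "\<forall>\<^sub>F n in sequentially. c n = 0"
proof -
  obtain p q where approx:
    "\<And>u v x y. smooth_fun u \<Longrightarrow> smooth_fun v \<Longrightarrow>
       (\<lambda>n. fd_apply (B n) (grid_values (dx n) (dy n) x y u) (grid_values (dx n) (dy n) x y v) (0, 0)
            - (second_order_op (p n) u x y + second_order_op (q n) v x y)) \<in> o(\<lambda>n. norm (p n, q n))"
    using assms(4) unfolding approximates_second_derivatives_def by blast
  let ?N = "\<lambda>n. norm (p n, q n)"
  have key: "(\<lambda>n. c n * (b + c') - (2 * d * fst (p n) + e * fst (snd (p n)) + 2 * f * snd (snd (p n))
         + (2 * d' * fst (q n) + e' * fst (snd (q n)) + 2 * f' * snd (snd (q n))))) \<in> o(?N)"
    for b c' d e f d' e' f'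
    using approx[OF smooth_fun_quadratic[of 0 b 0 d e f] smooth_fun_quadratic[of 0 0 c' d' e' f'], of 0 0]
    by (simp add: apply_B central_divergence_quadratic second_order_op_quadratic assms(1,2))
  \<comment> \<open>The test functions are \<open>u = x\<close>, \<open>v = 0\<close>.\<close>
  have "c \<in> o(?N)"
    using key[of 1 0 0 0 0 0 0 0] by simp
  \<comment> \<open>The factor \<open>1/2\<close> in front of the pure squares normalizes their second derivative to 1.\<close>
  have "(\<lambda>n. \<bar>fst (p n)\<bar> + \<bar>fst (snd (p n))\<bar> + \<bar>snd (snd (p n))\<bar> +
           (\<bar>fst (q n)\<bar> + \<bar>fst (snd (q n))\<bar> + \<bar>snd (snd (q n))\<bar>)) \<in> o(?N)"
    using key[of 0 0 "1/2" 0 0 0 0 0] key[of 0 0 0 1 0 0 0 0] key[of 0 0 0 0 "1/2" 0 0 0]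
      key[of 0 0 0 0 0 "1/2" 0 0] key[of 0 0 0 0 0 0 1 0] key[of 0 0 0 0 0 0 0 "1/2"]
    by (intro sum_in_smallo) simp_all
  then have "?N \<in> o(?N)"
    by (rule landau_o.big_small_trans[rotated])
       (intro landau_o.bigI[of 1] always_eventually allI, simp_all,
        use norm_coefficient_pair_le in \<open>smt (verit)\<close>)
  then have "\<forall>\<^sub>F n in sequentially. ?N n = 0"
    by (simp only: landau_o.small_refl_iff)
  moreover have "\<forall>\<^sub>F n in sequentially. norm (c n) \<le> 1 * norm (?N n)"
    using \<open>c \<in> o(?N)\<close> by (rule landau_o.smallD) simp
  ultimately show ?thesis
    by eventually_elim simp
qed

theorem theorem4p3:
  fixes dx dy :: "nat \<Rightarrow> real"
  assumes "\<And>n. dx n > 0" and "\<And>n. dy n > 0"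
    and "dx \<longlonglongrightarrow> 0" and "dy \<longlonglongrightarrow> 0"
  shows "\<not> (\<exists>B :: nat \<Rightarrow> fd_formula.
           (\<forall>n. B n \<noteq> 0 \<and> moore_stencil (B n) \<and>
                stationarity_consistent (dx n) (dy n) (B n) (central_divergence (dx n) (dy n))) \<and>
           approximates_second_derivatives dx dy B)"
proof
  assume "\<exists>B :: nat \<Rightarrow> fd_formula.
           (\<forall>n. B n \<noteq> 0 \<and> moore_stencil (B n) \<and>
                stationarity_consistent (dx n) (dy n) (B n) (central_divergence (dx n) (dy n))) \<and>
           approximates_second_derivatives dx dy B"
  then obtain B :: "nat \<Rightarrow> fd_formula" where
    B: "\<And>n. B n \<noteq> 0" "\<And>n. moore_stencil (B n)"
      "\<And>n. stationarity_consistent (dx n) (dy n) (B n) (central_divergence (dx n) (dy n))"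
    and approx: "approximates_second_derivatives dx dy B"
    by blast
  have nz: "dx n \<noteq> 0" "dy n \<noteq> 0" for n
    using assms(1,2)[of n] by simp_all
  have "\<exists>c. \<forall>n. (\<forall>S. Poly_Mapping.lookup (fst (B n)) S
            = c n * Poly_Mapping.lookup (fst (central_divergence (dx n) (dy n))) S) \<and>
      (\<forall>S. Poly_Mapping.lookup (snd (B n)) S
            = c n * Poly_Mapping.lookup (snd (central_divergence (dx n) (dy n))) S)"
    by (intro choice allI) (metis moore_stationarity_consistent_multiple nz B(2,3))
  then obtain c where
    c: "\<And>n S. Poly_Mapping.lookup (fst (B n)) S
            = c n * Poly_Mapping.lookup (fst (central_divergence (dx n) (dy n))) S"
      "\<And>n S. Poly_Mapping.lookup (snd (B n)) S
            = c n * Poly_Mapping.lookup (snd (central_divergence (dx n) (dy n))) S"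
    by blast
  have "\<forall>\<^sub>F n in sequentially. c n = 0"
    using nz _ approx
  proof (rule multiple_of_central_divergence_not_second_order)
    fix n u v I
    let ?A = "central_divergence (dx n) (dy n)"
    have "Poly_Mapping.keys (fst (B n)) \<union> Poly_Mapping.keys (snd (B n))
        \<subseteq> Poly_Mapping.keys (fst ?A) \<union> Poly_Mapping.keys (snd ?A)"
      by (auto simp: in_keys_iff c)
    then have "fd_apply (B n) u v I =
       (\<Sum>S\<in>Poly_Mapping.keys (fst ?A) \<union> Poly_Mapping.keys (snd ?A). Poly_Mapping.lookup (fst (B n)) S * u (I + S))
     + (\<Sum>S\<in>Poly_Mapping.keys (fst ?A) \<union> Poly_Mapping.keys (snd ?A). Poly_Mapping.lookup (snd (B n)) S * v (I + S))"
      by (intro fd_apply_superset) simp_all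
    also have "\<dots> = c n * fd_apply ?A u v I"
      by (subst fd_apply_superset[OF _ order_refl])
         (simp_all add: c sum_distrib_left distrib_left mult.assoc)
    finally show "fd_apply (B n) u v I = c n * fd_apply ?A u v I" .
  qed
  then obtain n where "c n = 0"
    by (auto simp: eventually_sequentially)
  then have "fst (B n) = 0" "snd (B n) = 0"
    by (simp_all add: poly_mapping_eq_iff fun_eq_iff c)
  then show False
    using B(1)[of n] by (simp add: prod_eq_iff)
qed

end
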